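(* Suppose: (i) for each $z\in\mathcal Z$, $c(z,\cdot)$ is Lipschitz continuous on $\mathcal Y$ with Lipschitz constant $L(z)$ satisfying $\sup_{z\in\mathcal Z}L(z)<+\infty$; (ii) for a.e. $x\in\mathcal X$, the functions $g^*_n(\cdot;x)$ converge in probability to $g(\cdot;x)$ uniformly on $\mathcal Z$; (iii) $\hat f_n(x)\xrightarrow{p}f^*(x)$ for a.e. $x\in\mathcal X$, and $\frac1n\sum_{i=1}^n\|f^*(x^i)-\hat f_n(x^i)\|^2\xrightarrow{p}0$; (iv) the radius $\zeta_n(x)$ is chosen such that, for some constant $\rho>1$, $\sup_{p\in\mathfrak P_n(x;\zeta_n(x))}\sum_{i=1}^n(p_i-\frac1n)^2=O(n^{-\rho})$ for a.e. $x\in\mathcal X$; (v) for a.e. $x\in\mathcal X$, $\sup_{z\in\mathcal Z}\mathbb E[(c(z,f^*(x)+\varepsilon))^2]<+\infty$ and $$\sup_{z\in\mathcal Z}\Big|\tfrac1n\sum_{i=1}^n(c(z,f^*(x)+\varepsilon^i))^2-\mathbb E[(c(z,f^*(x)+\varepsilon))^2]\Big|\xrightarrow{p}0;$$ (vi) the radius $\mu_n(x)$ satisfies $\lim_{n\to\infty}\mu_n(x)=0$ for a.e. $x\in\mathcal X$. Then, for a.e. $x\in\mathcal X$, the optimal value $\hat v^{DRO}_n(x)$ and set of optimal solutions $\hat S^{DRO}_n(x)$ of the ER-DRO problem satisfy $$\hat v^{DRO}_n(x)\xrightarrow{p}v^*(x),\qquad \mathbb D(\hat S^{DRO}_n(x),S^*(x))\xrightarrow{p}0,\qquad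 \sup_{z\in\hat S^{DRO}_n(x)}g(z;x)\xrightarrow{p}v^*(x).$$
   Context: Setup. $Y=f^*(X)+\varepsilon$, where $X$ is a random vector with support $\mathcal X\subseteq\mathbb R^{d_x}$ and distribution $P_X$, $Y$ has nonempty convex support $\mathcal Y\subseteq\mathbb R^{d_y}$, $f^*(x):=\mathbb E[Y\mid X=x]$, and the zero-mean error $\varepsilon$ is independent of $X$. "A.e. $x$" is with respect to $P_X$. $\|\cdot\|$ is the Euclidean norm; $\mathbb D(A,B):=\sup_{v\in A}\inf_{w\in B}\|v-w\|$. $\mathcal Z\subseteq\mathbb R^{d_z}$ is nonempty and compact, $c:\mathcal Z\times\mathcal Y\to\mathbb R$, $\mathbb E|c(z,f^*(x)+\varepsilon)|<\infty$ for each $z\in\mathcal Z$ and a.e. $x$, and $g(z;x):=\mathbb E[c(z,f^*(x)+\varepsilon)]$ is lower semicontinuous in $z$ on $\mathcal Z$ for a.e. $x$. The true problem is $v^*(x):=\min_{z\in\mathcal Z}g(z;x)$ with set of optimal solutions $S^*(x)$. All functions, sets and selections are assumed measurable. Data. $\mathcal D_n=\{(y^i,x^i)\}_{i=1}^n$ are joint observations of $(Y,X)$, $\varepsilon^i:=y^i-f^*(x^i)$; $\hat f_n$ is an estimate of $f^*$ built from $\mathcal D_n$ by a regression method, with residuals $\hat\varepsilon^i_n:=y^i-\hat f_n(x^i)$. Convergence in probability refers to the data. $g^*_n(z;x):=\frac1n\sum_{i=1}^nc(z,f^*(x)+\varepsilon^i)$. $\mathrm{proj}_{\mathcal Y}$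 is the orthogonal projection onto $\mathcal Y$. Ambiguity set. For nonnegative radii $\mu_n(x),\zeta_n(x)$, $$\hat{\mathcal P}_n(x):=\Big\{Q=\sum_{i=1}^np_i\delta_{\bar y^i}: p\in\mathfrak P_n(x;\zeta_n(x)),\ \bar y^i\in\hat{\mathcal Y}^i_n(x;\mu_n(x)),\ i=1,\dots,n\Big\},$$ $$\hat{\mathcal Y}^i_n(x;\mu):=\{y\in\mathcal Y:\|y-\mathrm{proj}_{\mathcal Y}(\hat f_n(x)+\hat\varepsilon^i_n)\|\le\mu\},$$ where $\delta$ is the Dirac measure and $\mathfrak P_n(x;\zeta)\subseteq\mathbb R^n$ is a given family of sets of probability vectors ($p\ge0$, $\sum_ip_i=1$ for all $p\in\mathfrak P_n(x;\zeta)$) with $\lim_{\zeta\downarrow0}\mathfrak P_n(x;\zeta)=\mathfrak P_n(x;0)=\{(\frac1n,\dots,\frac1n)\}$ for each $x$. ER-DRO problem. $\hat v^{DRO}_n(x)=\min_{z\in\mathcal Z}\sup_{Q\in\hat{\mathcal P}_n(x)}\mathbb E_{Y\sim Q}[c(z,Y)]$, with set of optimal solutions $\hat S^{DRO}_n(x)$; its objective is assumed real-valued and lower semicontinuous on $\mathcal Z$ for each $x$. *)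

theory Defs
  imports "HOL-Probability.Probability"
begin

definition rv_support :: "'w measure \<Rightarrow> ('w \<Rightarrow> 'a::topological_space) \<Rightarrow> 'a set" where
  "rv_support M V = {v. \<forall>U. open U \<and> v \<in> U \<longrightarrow> 0 < emeasure (distr M borel V) U}"

text \<open>Convergence in probability to a finite limit. The values are extended reals so that suprema
  of unbounded families keep their meaning. The outer measure agrees with the probability
  whenever the event is measurable; its use avoids separate measurability hypotheses on
  suprema, optimal values and set deviations.\<close>

definition conv_in_prob :: "'w measure \<Rightarrow> (nat \<Rightarrow> 'w \<Rightarrow> ereal) \<Rightarrow> ereal \<Rightarrow> bool" where
  "conv_in_prob M U l \<longleftrightarrow> (\<forall>e::real. 0 < e \<longrightarrow>
     (\<lambda>n. outer_measure_of M {\<omega> \<in> space M. ereal e < \<bar>U n \<omega> - l\<bar>}) \<longlonglongrightarrow> 0)"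

lemma conv_in_prob_iff_prob:
  assumes "prob_space M" and [measurable]: "\<And>n. U n \<in> borel_measurable M"
  shows "conv_in_prob M (\<lambda>n \<omega>. ereal (U n \<omega>)) (ereal l) \<longleftrightarrow>
    (\<forall>e>0. (\<lambda>n. measure M {\<omega> \<in> space M. e < \<bar>U n \<omega> - l\<bar>}) \<longlonglongrightarrow> 0)"
proof -
  interpret prob_space M by fact
  have eq: "outer_measure_of M {\<omega> \<in> space M. ereal e < \<bar>ereal (U n \<omega>) - ereal l\<bar>}
      = ennreal (measure M {\<omega> \<in> space M. e < \<bar>U n \<omega> - l\<bar>})" for n and e :: real
    by (simp add: emeasure_eq_measure)
  show ?thesis
    unfolding conv_in_prob_def eq
    by (simp add: tendsto_ennreal_iff flip: ennreal_0)
qed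

definition lsc_on :: "'a::topological_space set \<Rightarrow> ('a \<Rightarrow> ereal) \<Rightarrow> bool" where
  "lsc_on Z h \<longleftrightarrow> (\<forall>z\<in>Z. h z \<le> Liminf (at z within Z) h)"

definition opt_value :: "'a set \<Rightarrow> ('a \<Rightarrow> ereal) \<Rightarrow> ereal" where
  "opt_value Z h = (INF z\<in>Z. h z)"

definition opt_set :: "'a set \<Rightarrow> ('a \<Rightarrow> ereal) \<Rightarrow> 'a set" where
  "opt_set Z h = {z. is_arg_min h (\<lambda>z. z \<in> Z) z}"

definition deviation :: "'a::real_normed_vector set \<Rightarrow> 'a set \<Rightarrow> ereal" where
  "deviation A B = (SUP v\<in>A. INF w\<in>B. ereal (norm (v - w)))"

text \<open>Painleve-Kuratowski set convergence.\<close>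

definition set_liminf :: "('t \<Rightarrow> 'a::topological_space set) \<Rightarrow> 't filter \<Rightarrow> 'a set" where
  "set_liminf A F = {u. \<forall>U. open U \<and> u \<in> U \<longrightarrow> (\<forall>\<^sub>F t in F. A t \<inter> U \<noteq> {})}"

definition set_limsup :: "('t \<Rightarrow> 'a::topological_space set) \<Rightarrow> 't filter \<Rightarrow> 'a set" where
  "set_limsup A F = {u. \<forall>U. open U \<and> u \<in> U \<longrightarrow> (\<exists>\<^sub>F t in F. A t \<inter> U \<noteq> {})}"

definition set_converges :: "('t \<Rightarrow> 'a::topological_space set) \<Rightarrow> 'a set \<Rightarrow> 't filter \<Rightarrow> bool" where
  "set_converges A L F \<longleftrightarrow> set_liminf A F = L \<and> set_limsup A F = L"

text \<open>A vector of \<open>\<real>\<^sup>n\<close> is a function on \<^typ>\<open>nat\<close> that vanishes outside \<open>{1..n}\<close>; on these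
  functions the product topology of \<^typ>\<open>nat \<Rightarrow> real\<close> is the Euclidean one.\<close>

definition prob_vectors :: "nat \<Rightarrow> (nat \<Rightarrow> real) set" where
  "prob_vectors n =
     {p. (\<forall>i\<in>{1..n}. 0 \<le> p i) \<and> (\<Sum>i=1..n. p i) = 1 \<and> (\<forall>i. i \<notin> {1..n} \<longrightarrow> p i = 0)}"

definition uniform_vector :: "nat \<Rightarrow> nat \<Rightarrow> real" where
  "uniform_vector n = (\<lambda>i. if i \<in> {1..n} then 1 / real n else 0)"

text \<open>The measure \<open>\<Sum>i=1..n. p i \<cdot> \<delta>(ybar i)\<close> on the Borel sets of \<open>S\<close>, for \<open>ybar i \<in> S\<close>.\<close>

definition discrete_law ::
    "'y::topological_space set \<Rightarrow> nat \<Rightarrow> (nat \<Rightarrow> real) \<Rightarrow> (nat \<Rightarrow> 'y) \<Rightarrow> 'y measure" where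
  "discrete_law S n p ybar =
     distr (point_measure {1..n} (\<lambda>i. ennreal (p i))) (restrict_space borel S) ybar"

lemma emeasure_discrete_law:
  assumes "\<And>i. i \<in> {1..n} \<Longrightarrow> ybar i \<in> S" and B: "B \<in> sets (restrict_space borel S)"
  shows "emeasure (discrete_law S n p ybar) B =
    (\<Sum>i=1..n. ennreal (p i) * emeasure (return (restrict_space borel S) (ybar i)) B)"
proof -
  let ?P = "point_measure {1..n} (\<lambda>i. ennreal (p i))"
  have m: "ybar \<in> measurable ?P (restrict_space borel S)"
    using assms(1)
    by (auto simp: measurable_def space_point_measure sets_point_measure space_restrict_space)
  have "emeasure (discrete_law S n p ybar) B = (\<Sum>i\<in>{1..n} \<inter> ybar -` B. ennreal (p i))"
    unfolding discrete_law_def using B m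
    by (subst emeasure_distr) (auto simp: space_point_measure emeasure_point_measure_finite
        intro!: sum.cong)
  also have "\<dots> = (\<Sum>i=1..n. ennreal (p i) * indicator B (ybar i))"
    by (auto simp: sum.inter_restrict indicator_def intro!: sum.cong)
  finally show ?thesis using B by simp
qed

text \<open>A data set is a sequence \<open>d\<close> of pairs \<open>d i = (y\<^sup>i, x\<^sup>i)\<close>, \<open>i \<ge> 1\<close>. A regression method
  \<open>reg n\<close> receives only the first \<open>n\<close> pairs.\<close>

definition fhat :: "(nat \<Rightarrow> (nat \<Rightarrow> 'y \<times> 'x) \<Rightarrow> 'x \<Rightarrow> 'y) \<Rightarrow> nat \<Rightarrow> (nat \<Rightarrow> 'y \<times> 'x) \<Rightarrow> 'x \<Rightarrow> 'y" where
  "fhat reg n d = reg n (restrict d {1..n})"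

definition residual ::
    "(nat \<Rightarrow> (nat \<Rightarrow> 'y \<times> 'x) \<Rightarrow> 'x \<Rightarrow> 'y::minus) \<Rightarrow> nat \<Rightarrow> (nat \<Rightarrow> 'y \<times> 'x) \<Rightarrow> nat \<Rightarrow> 'y" where
  "residual reg n d i = fst (d i) - fhat reg n d (snd (d i))"

definition atom_region ::
    "(nat \<Rightarrow> (nat \<Rightarrow> 'y \<times> 'x) \<Rightarrow> 'x \<Rightarrow> 'y::euclidean_space) \<Rightarrow> 'y set \<Rightarrow> nat \<Rightarrow>
     (nat \<Rightarrow> 'y \<times> 'x) \<Rightarrow> 'x \<Rightarrow> real \<Rightarrow> nat \<Rightarrow> 'y set" where
  "atom_region reg S n d x \<mu> i =
     {y \<in> S. norm (y - closest_point S (fhat reg n d x + residual reg n d i)) \<le> \<mu>}"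

definition ambiguity_set ::
    "(nat \<Rightarrow> (nat \<Rightarrow> 'y \<times> 'x) \<Rightarrow> 'x \<Rightarrow> 'y::euclidean_space) \<Rightarrow> 'y set \<Rightarrow>
     (nat \<Rightarrow> 'x \<Rightarrow> real \<Rightarrow> (nat \<Rightarrow> real) set) \<Rightarrow> (nat \<Rightarrow> 'x \<Rightarrow> real) \<Rightarrow> (nat \<Rightarrow> 'x \<Rightarrow> real) \<Rightarrow>
     nat \<Rightarrow> (nat \<Rightarrow> 'y \<times> 'x) \<Rightarrow> 'x \<Rightarrow> 'y measure set" where
  "ambiguity_set reg S \<PP> \<mu> \<zeta> n d x =
     {discrete_law S n p ybar | p ybar.
        p \<in> \<PP> n x (\<zeta> n x) \<and> (\<forall>i\<in>{1..n}. ybar i \<in> atom_region reg S n d x (\<mu> n x) i)}"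

definition worst_case :: "('z \<Rightarrow> 'y \<Rightarrow> real) \<Rightarrow> 'y measure set \<Rightarrow> 'z \<Rightarrow> ereal" where
  "worst_case c \<Q> z = (SUP Q\<in>\<Q>. ereal (integral\<^sup>L Q (c z)))"

end

theory Submission
  imports Defs
begin

text \<open>Independence and Fubini give \<open>f x + \<epsilon> \<in> \<Y>\<close> almost surely for almost every \<open>x\<close>; only on such
  points is \<open>c z\<close> controlled. The projection onto the closed convex set \<open>\<Y>\<close> is nonexpansive and fixes
  \<open>f x + \<epsilon>s i\<close>, so every admissible atom lies within \<open>\<mu> n x + norm (fn n x - f x) + b i\<close> of
  \<open>f x + \<epsilon>s i\<close>, where \<open>b i\<close> is the regression error at the \<open>i\<close>-th covariate. By the Lipschitz
  condition and Cauchy-Schwarz (the scaled weight deviation \<open>\<surd>n \<cdot> L2_set (\<lambda>i. p i - 1/n)\<close> vanishes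
  because \<open>\<rho> > 1\<close>), the robust objective is uniformly close to \<open>gstar\<close>, hence to \<open>g\<close>, with
  high probability. Lower semicontinuity of \<open>g\<close> on the compact \<open>Z\<close> turns this into convergence of
  optimal values and solutions.\<close>

section \<open>Events of outer probability tending to one\<close>

text \<open>Working with the outer measure of the exceptional event lets suprema over
  \<open>Z\<close>, optimal values and deviations be treated by inclusion of events alone, without
  measurability checks.\<close>

definition with_high_prob :: "'w measure \<Rightarrow> (nat \<Rightarrow> 'w \<Rightarrow> bool) \<Rightarrow> bool" where
  "with_high_prob M P \<longleftrightarrow> (\<lambda>n. outer_measure_of M {\<omega> \<in> space M. \<not> P n \<omega>}) \<longlonglongrightarrow> 0"

lemma conv_in_prob_iff_with_high_prob:
  "conv_in_prob M U l \<longleftrightarrow> (\<forall>e>0. with_high_prob M (\<lambda>n \<omega>. \<bar>U n \<omega> - l\<bar> \<le> ereal e))"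
  by (simp add: conv_in_prob_def with_high_prob_def not_le)

lemma conv_in_probD:
  "conv_in_prob M U l \<Longrightarrow> 0 < e \<Longrightarrow> with_high_prob M (\<lambda>n \<omega>. \<bar>U n \<omega> - l\<bar> \<le> ereal e)"
  by (simp add: conv_in_prob_iff_with_high_prob)

text \<open>Measurable covers attain the outer measures of subsets of the space, and together they
  cover the union. A set not contained in \<open>space M\<close> has no measurable cover, so its
  outer measure is \<open>top\<close> and the bound is trivial.\<close>

lemma outer_measure_of_subadditive:
  "outer_measure_of M (A \<union> B) \<le> outer_measure_of M A + outer_measure_of M B"
proof (cases "A \<subseteq> space M \<and> B \<subseteq> space M")
  case True
  obtain E where E: "E \<in> sets M" "A \<subseteq> E" "outer_measure_of M A = emeasure M E"
    using outer_measure_of_attain[of A M] True by blast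
  obtain F where F: "F \<in> sets M" "B \<subseteq> F" "outer_measure_of M B = emeasure M F"
    using outer_measure_of_attain[of B M] True by blast
  have "outer_measure_of M (A \<union> B) \<le> outer_measure_of M (E \<union> F)"
    using E F by (intro outer_measure_of_mono) auto
  also have "\<dots> \<le> emeasure M E + emeasure M F"
    using E F by (simp add: emeasure_subadditive)
  finally show ?thesis
    using E F by simp
next
  case False
  have "outer_measure_of M C = top" if "\<not> C \<subseteq> space M" for C
    using that sets.sets_into_space[of _ M]
    by (auto simp: outer_measure_of_def intro!: INF_eqI)
  then have "outer_measure_of M A = top \<or> outer_measure_of M B = top"
    using False by blast
  then show ?thesis by auto
qed

text \<open>The implication is required only for large \<open>n\<close>, so that deterministic
  limits, such as that of the radius \<open>\<mu> n x\<close>, can be combined with random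
  events.\<close>

lemma with_high_prob_mono:
  assumes "with_high_prob M P"
    and "\<forall>\<^sub>F n in sequentially. \<forall>\<omega>\<in>space M. P n \<omega> \<longrightarrow> Q n \<omega>"
  shows "with_high_prob M Q"
  unfolding with_high_prob_def
proof (rule tendsto_sandwich[OF _ _ tendsto_const assms(1)[unfolded with_high_prob_def]])
  show "\<forall>\<^sub>F n in sequentially. outer_measure_of M {\<omega> \<in> space M. \<not> Q n \<omega>}
      \<le> outer_measure_of M {\<omega> \<in> space M. \<not> P n \<omega>}"
    using assms(2) by eventually_elim (auto intro!: outer_measure_of_mono)
qed simp

lemma with_high_prob_conj:
  assumes "with_high_prob M P" "with_high_prob M Q"
  shows "with_high_prob M (\<lambda>n \<omega>. P n \<omega> \<and> Q n \<omega>)"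
  unfolding with_high_prob_def
proof (rule tendsto_sandwich[OF _ _ tendsto_const])
  show "\<forall>\<^sub>F n in sequentially. outer_measure_of M {\<omega> \<in> space M. \<not> (P n \<omega> \<and> Q n \<omega>)}
      \<le> outer_measure_of M {\<omega> \<in> space M. \<not> P n \<omega>} + outer_measure_of M {\<omega> \<in> space M. \<not> Q n \<omega>}"
    by (intro always_eventually allI order_trans[OF outer_measure_of_mono outer_measure_of_subadditive])
      auto
  show "(\<lambda>n. outer_measure_of M {\<omega> \<in> space M. \<not> P n \<omega>}
      + outer_measure_of M {\<omega> \<in> space M. \<not> Q n \<omega>}) \<longlonglongrightarrow> 0"
    using tendsto_add[OF assms[unfolded with_high_prob_def]] by simp
qed simp

lemma with_high_prob_AE:
  assumes "\<And>n. AE \<omega> in M. P n \<omega>"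
  shows "with_high_prob M P"
proof -
  have "outer_measure_of M {\<omega> \<in> space M. \<not> P n \<omega>} = 0" for n
  proof -
    obtain E where E: "E \<in> null_sets M" "{\<omega> \<in> space M. \<not> P n \<omega>} \<subseteq> E"
      using assms[of n] unfolding eventually_ae_filter by blast
    then have "outer_measure_of M {\<omega> \<in> space M. \<not> P n \<omega>} \<le> outer_measure_of M E"
      by (intro outer_measure_of_mono)
    with E show ?thesis by (simp add: null_setsD1 null_setsD2)
  qed
  then show ?thesis by (simp add: with_high_prob_def)
qed

section \<open>Lower semicontinuous minimization over compact sets\<close>

text \<open>Passing to a subset makes the filter \<open>at z within K\<close> finer, which can only
  raise the lower limit.\<close>

lemma lsc_on_subset: "lsc_on Z h \<Longrightarrow> K \<subseteq> Z \<Longrightarrow> lsc_on K h"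
  unfolding lsc_on_def le_Liminf_iff
  by (meson at_le filter_leD subsetD)

text \<open>If no point were minimal, every \<open>z\<close> would have a strictly better
  \<open>b z\<close> in \<open>Z\<close>, by semicontinuity better than all points of
  \<open>Z\<close> near \<open>z\<close>. Among the finitely many \<open>b t\<close> of a finite
  subcover the best one lies in some \<open>U s\<close> and is beaten by \<open>b s\<close>, a
  contradiction.\<close>

lemma lsc_on_attains_min:
  assumes "compact Z" "Z \<noteq> {}" "lsc_on Z h"
  shows "\<exists>z\<in>Z. \<forall>w\<in>Z. h z \<le> h w"
proof (rule ccontr)
  assume "\<not> ?thesis"
  then have above: "\<exists>w\<in>Z. h w < h z" if "z \<in> Z" for z
    using that by (auto simp: not_le)
  have "\<exists>U b. open U \<and> z \<in> U \<and> b \<in> Z \<and> (\<forall>w\<in>U \<inter> Z. h b < h w)" if "z \<in> Z" for z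
  proof -
    obtain b where b: "b \<in> Z" "h b < h z" using above[OF \<open>z \<in> Z\<close>] by blast
    then have "\<forall>\<^sub>F w in at z within Z. h b < h w"
      using \<open>lsc_on Z h\<close> \<open>z \<in> Z\<close> unfolding lsc_on_def le_Liminf_iff by blast
    then obtain U where "open U" "z \<in> U" "\<forall>w\<in>U. w \<noteq> z \<longrightarrow> w \<in> Z \<longrightarrow> h b < h w"
      unfolding eventually_at_topological by blast
    \<comment> \<open>The punctured filter leaves out \<open>z\<close> itself, where
      \<open>h b < h z\<close> is already known.\<close>
    with b show ?thesis by (metis IntD1 IntD2)
  qed
  then obtain U b where U: "\<And>z. z \<in> Z \<Longrightarrow> open (U z) \<and> z \<in> U z \<and> b z \<in> Z \<and> (\<forall>w\<in>U z \<inter> Z. h (b z) < h w)"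
    by metis
  obtain T where T: "T \<subseteq> Z" "finite T" "Z \<subseteq> (\<Union>z\<in>T. U z)"
    using compactE_image[OF \<open>compact Z\<close>, of Z U] U by blast
  with \<open>Z \<noteq> {}\<close> have "T \<noteq> {}" by auto
  then have "Min ((\<lambda>s. h (b s)) ` T) \<in> (\<lambda>s. h (b s)) ` T"
    using T(2) by (intro Min_in) auto
  then obtain t where t: "t \<in> T" "\<forall>s\<in>T. h (b t) \<le> h (b s)"
    using T(2) by (auto simp: eq_commute[of "Min _"])
  then have "b t \<in> Z" using T U by blast
  then obtain s where "s \<in> T" "b t \<in> U s" using T by blast
  then have "h (b s) < h (b t)" using U T \<open>b t \<in> Z\<close> by blast
  with t \<open>s \<in> T\<close> show False by force
qed

text \<open>The feasible points at distance at least \<open>e\<close> from every optimal solution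
  form a compact set \<open>K\<close>. If \<open>K\<close> is nonempty, the minimum of
  \<open>g\<close> over it exceeds the optimal value, and half of this gap serves as
  \<open>d\<close>.\<close>

lemma near_optimal_near_opt_set:
  fixes Z :: "'z::euclidean_space set" and g :: "'z \<Rightarrow> real"
  assumes "compact Z" "Z \<noteq> {}" "lsc_on Z (\<lambda>z. ereal (g z))" "0 < e"
    and z0: "z0 \<in> Z" "\<forall>w\<in>Z. g z0 \<le> g w"
  shows "\<exists>d>0. \<forall>z\<in>Z. g z \<le> g z0 + d \<longrightarrow> (\<exists>w\<in>opt_set Z (\<lambda>z. ereal (g z)). norm (z - w) < e)"
proof -
  define S where "S = opt_set Z (\<lambda>z. ereal (g z))"
  define K where "K = Z \<inter> (\<Inter>w\<in>S. {z. e \<le> norm (z - w)})"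
  show ?thesis
  proof (cases "K = {}")
    case True
    \<comment> \<open>Every feasible point is now within \<open>e\<close> of an optimal one, so any
      positive \<open>d\<close> works.\<close>
    then show ?thesis unfolding K_def S_def by (intro exI[of _ 1]) (fastforce simp: not_le)
  next
    case False
    have "compact K"
      unfolding K_def using assms(1)
      by (intro compact_Int_closed closed_INT ballI closed_Collect_le continuous_intros) auto
    moreover have "lsc_on K (\<lambda>z. ereal (g z))"
      using assms(3) by (rule lsc_on_subset) (auto simp: K_def)
    ultimately obtain z1 where z1: "z1 \<in> K" "\<forall>w\<in>K. g z1 \<le> g w"
      using lsc_on_attains_min[of K "\<lambda>z. ereal (g z)"] False by auto
    \<comment> \<open>A member of \<open>S\<close> has distance zero to itself, so it cannot lie in
      \<open>K\<close>.\<close>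
    have "z1 \<notin> S" using z1(1) \<open>0 < e\<close> by (auto simp: K_def)
    then have less: "g z0 < g z1"
      using z0 z1(1) unfolding S_def opt_set_def is_arg_min_linorder K_def
      by (auto simp: not_le intro: le_less_trans)
    show ?thesis
    proof (intro exI[of _ "(g z1 - g z0) / 2"] conjI ballI impI)
      fix z assume z: "z \<in> Z" "g z \<le> g z0 + (g z1 - g z0) / 2"
      then have "g z < g z1" using less by (simp add: field_simps)
      then have "z \<notin> K" using z1(2) by force
      then show "\<exists>w\<in>opt_set Z (\<lambda>z. ereal (g z)). norm (z - w) < e"
        using z(1) by (auto simp: K_def S_def not_le)
    qed (use less in simp)
  qed
qed

lemma ereal_abs_diff_le_iff:
  "\<bar>x - ereal r\<bar> \<le> ereal d \<longleftrightarrow> ereal (r - d) \<le> x \<and> x \<le> ereal (r + d)"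
  by (cases x) (auto simp: abs_le_iff)

text \<open>Exact minimizers of an objective uniformly \<open>d\<close>-close to \<open>g\<close> are \<open>2 d\<close>-optimal for \<open>g\<close>.\<close>

lemma conv_in_prob_optimization:
  fixes Z :: "'z::euclidean_space set" and g :: "'z \<Rightarrow> real"
  assumes Z: "compact Z" "Z \<noteq> {}" and g: "lsc_on Z (\<lambda>z. ereal (g z))"
    and h: "\<And>n \<omega>. 1 \<le> n \<Longrightarrow> \<omega> \<in> space N \<Longrightarrow> lsc_on Z (h n \<omega>)"
    and unif: "\<And>d. 0 < d \<Longrightarrow> with_high_prob N (\<lambda>n \<omega>. \<forall>z\<in>Z. \<bar>h n \<omega> z - ereal (g z)\<bar> \<le> ereal d)"
  shows "conv_in_prob N (\<lambda>n \<omega>. opt_value Z (h n \<omega>)) (opt_value Z (\<lambda>z. ereal (g z)))" (is ?value)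
    and "conv_in_prob N (\<lambda>n \<omega>. deviation (opt_set Z (h n \<omega>)) (opt_set Z (\<lambda>z. ereal (g z)))) 0"
      (is ?deviation)
    and "conv_in_prob N (\<lambda>n \<omega>. SUP z\<in>opt_set Z (h n \<omega>). ereal (g z)) (opt_value Z (\<lambda>z. ereal (g z)))"
      (is ?sup)
proof -
  obtain z0 where z0: "z0 \<in> Z" "\<forall>w\<in>Z. g z0 \<le> g w"
    using lsc_on_attains_min[OF Z g] by auto
  have v: "opt_value Z (\<lambda>z. ereal (g z)) = ereal (g z0)"
    unfolding opt_value_def using z0 by (intro antisym INF_lower INF_greatest) auto
  \<comment> \<open>What all three limits use at a single outcome. Minimality against
    \<open>z0\<close> gives \<open>g z - d \<le> h n \<omega> z \<le> h n \<omega> z0 \<le> g z0 +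
    d\<close>; nonemptiness comes from the semicontinuity of \<open>h n \<omega>\<close>.\<close>
  have event: "opt_set Z (h n \<omega>) \<noteq> {}
      \<and> (\<forall>z\<in>opt_set Z (h n \<omega>). z \<in> Z \<and> g z \<le> g z0 + 2 * d
          \<and> ereal (g z0 - d) \<le> h n \<omega> z \<and> h n \<omega> z \<le> ereal (g z0 + d)
          \<and> opt_value Z (h n \<omega>) = h n \<omega> z)"
    if "1 \<le> n" "\<omega> \<in> space N" and near: "\<forall>z\<in>Z. \<bar>h n \<omega> z - ereal (g z)\<bar> \<le> ereal d" for n \<omega> d
  proof (intro conjI ballI)
    show "opt_set Z (h n \<omega>) \<noteq> {}"
      using lsc_on_attains_min[OF Z h[OF that(1,2)]] by (auto simp: opt_set_def is_arg_min_linorder)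
  next
    fix z assume "z \<in> opt_set Z (h n \<omega>)"
    then have z: "z \<in> Z" "\<And>w. w \<in> Z \<Longrightarrow> h n \<omega> z \<le> h n \<omega> w"
      by (auto simp: opt_set_def is_arg_min_linorder)
    then show "z \<in> Z" by simp
    have n: "ereal (g w - d) \<le> h n \<omega> w \<and> h n \<omega> w \<le> ereal (g w + d)" if "w \<in> Z" for w
      using near that by (auto simp: ereal_abs_diff_le_iff)
    have "h n \<omega> z \<le> h n \<omega> z0" using z z0 by blast
    also have "\<dots> \<le> ereal (g z0 + d)" using n z0 by blast
    finally show u: "h n \<omega> z \<le> ereal (g z0 + d)" .
    have l: "ereal (g z - d) \<le> h n \<omega> z" using n z by blast
    then have "ereal (g z - d) \<le> ereal (g z0 + d)" using u by (rule order_trans)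
    then show "g z \<le> g z0 + 2 * d" by simp
    have "ereal (g z0 - d) \<le> ereal (g z - d)" using z0 z by auto
    then show "ereal (g z0 - d) \<le> h n \<omega> z" using l by (rule order_trans)
    show "opt_value Z (h n \<omega>) = h n \<omega> z"
      unfolding opt_value_def using z by (intro antisym INF_lower INF_greatest) auto
  qed
  have ev: "\<forall>\<^sub>F n::nat in sequentially. 1 \<le> n" by (rule eventually_ge_at_top)
  show ?value
    unfolding conv_in_prob_iff_with_high_prob v
  proof (intro allI impI)
    fix e :: real assume "0 < e"
    from unif[OF this]
    show "with_high_prob N (\<lambda>n \<omega>. \<bar>opt_value Z (h n \<omega>) - ereal (g z0)\<bar> \<le> ereal e)"
    proof (rule with_high_prob_mono, use ev in eventually_elim, intro ballI impI)
      fix n \<omega> assume "1 \<le> n" "\<omega> \<in> space N" "\<forall>z\<in>Z. \<bar>h n \<omega> z - ereal (g z)\<bar> \<le> ereal e"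
      note E = event[OF this]
      then obtain z where "z \<in> opt_set Z (h n \<omega>)" by blast
      with E show "\<bar>opt_value Z (h n \<omega>) - ereal (g z0)\<bar> \<le> ereal e"
        by (auto simp: ereal_abs_diff_le_iff)
    qed
  qed
  show ?sup
    unfolding conv_in_prob_iff_with_high_prob v
  proof (intro allI impI)
    fix e :: real assume "0 < e"
    \<comment> \<open>The loss of a factor two in passing to minimizers turns closeness
      \<open>e / 2\<close> into the tolerance \<open>e\<close>.\<close>
    then have "0 < e / 2" by simp
    from unif[OF this]
    show "with_high_prob N (\<lambda>n \<omega>. \<bar>(SUP z\<in>opt_set Z (h n \<omega>). ereal (g z)) - ereal (g z0)\<bar> \<le> ereal e)"
    proof (rule with_high_prob_mono, use ev in eventually_elim, intro ballI impI)
      fix n \<omega> assume "1 \<le> n" "\<omega> \<in> space N" "\<forall>z\<in>Z. \<bar>h n \<omega> z - ereal (g z)\<bar> \<le> ereal (e / 2)"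
      note E = event[OF this]
      then obtain z where z: "z \<in> opt_set Z (h n \<omega>)" by blast
      have "ereal (g z0 - e) \<le> ereal (g z)" using E z z0 \<open>0 < e\<close> by force
      also have "\<dots> \<le> (SUP z\<in>opt_set Z (h n \<omega>). ereal (g z))" using z by (rule SUP_upper)
      finally show "\<bar>(SUP z\<in>opt_set Z (h n \<omega>). ereal (g z)) - ereal (g z0)\<bar> \<le> ereal e"
        using E by (auto simp: ereal_abs_diff_le_iff intro!: SUP_least)
    qed
  qed
  show ?deviation
    unfolding conv_in_prob_iff_with_high_prob
  proof (intro allI impI)
    fix e :: real assume "0 < e"
    let ?S = "opt_set Z (\<lambda>z. ereal (g z))"
    obtain d where d: "0 < d" "\<And>z. z \<in> Z \<Longrightarrow> g z \<le> g z0 + d \<Longrightarrow> \<exists>w\<in>?S. norm (z - w) < e"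
      using near_optimal_near_opt_set[OF Z g \<open>0 < e\<close> z0] by blast
    \<comment> \<open>Closeness \<open>d / 2\<close> makes every minimizer of
      \<open>h n \<omega>\<close> a \<open>d\<close>-optimal point of \<open>g\<close>, as the
      choice of \<open>d\<close> requires.\<close>
    then have "0 < d / 2" by simp
    from unif[OF this]
    show "with_high_prob N (\<lambda>n \<omega>. \<bar>deviation (opt_set Z (h n \<omega>)) ?S - 0\<bar> \<le> ereal e)"
    proof (rule with_high_prob_mono, use ev in eventually_elim, intro ballI impI)
      fix n \<omega> assume "1 \<le> n" "\<omega> \<in> space N" "\<forall>z\<in>Z. \<bar>h n \<omega> z - ereal (g z)\<bar> \<le> ereal (d / 2)"
      note E = event[OF this]
      \<comment> \<open>An element is needed for the lower bound: the deviation of the empty set is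
        \<open>-\<infinity>\<close>, not \<open>0\<close>.\<close>
      then obtain z where z: "z \<in> opt_set Z (h n \<omega>)" by blast
      have "0 \<le> (INF w\<in>?S. ereal (norm (z - w)))" by (intro INF_greatest) simp
      also have "\<dots> \<le> deviation (opt_set Z (h n \<omega>)) ?S"
        unfolding deviation_def using z by (rule SUP_upper)
      finally have "0 \<le> deviation (opt_set Z (h n \<omega>)) ?S" .
      moreover have "deviation (opt_set Z (h n \<omega>)) ?S \<le> ereal e"
        unfolding deviation_def
      proof (rule SUP_least)
        fix z assume "z \<in> opt_set Z (h n \<omega>)"
        then obtain w where "w \<in> ?S" "norm (z - w) < e" using E d(2)[of z] by auto
        then show "(INF w\<in>?S. ereal (norm (z - w))) \<le> ereal e"
          by (intro INF_lower2[of w]) auto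
      qed
      ultimately show "\<bar>deviation (opt_set Z (h n \<omega>)) ?S - 0\<bar> \<le> ereal e" by simp
    qed
  qed
qed

section \<open>Deterministic bound for reweighted averages\<close>

lemma ereal_abs_diff_triangle:
  "\<bar>x - ereal r\<bar> \<le> ereal a \<Longrightarrow> \<bar>r - s\<bar> \<le> b \<Longrightarrow> \<bar>x - ereal s\<bar> \<le> ereal (a + b)"
  by (cases x) auto

lemma sum_mult_le_L2_set: "\<bar>\<Sum>i\<in>A. f i * g i\<bar> \<le> L2_set f A * L2_set g A"
  by (rule order_trans[OF sum_abs]) (use L2_set_mult_ineq[of f g A] in \<open>simp add: abs_mult\<close>)

text \<open>Write \<open>p i = 1/n + q i\<close> and apply Cauchy-Schwarz to each of the sums against \<open>q\<close>.\<close>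

lemma weighted_average_diff_le:
  fixes n :: nat and p b u v :: "nat \<Rightarrow> real"
  defines "q \<equiv> \<lambda>i. p i - 1 / real n"
  assumes n: "1 \<le> n" and p: "p \<in> prob_vectors n" and "0 \<le> K"
    and uv: "\<And>i. i \<in> {1..n} \<Longrightarrow> \<bar>u i - v i\<bar> \<le> K * (a + b i)"
    and q: "sqrt n * L2_set q {1..n} \<le> t"
    and b: "L2_set b {1..n} \<le> sqrt n * \<beta>" and v: "L2_set v {1..n} \<le> sqrt n * \<gamma>"
  shows "\<bar>(\<Sum>i=1..n. p i * u i) - 1 / real n * (\<Sum>i=1..n. v i)\<bar>
           \<le> K * (a + \<beta> + t * \<beta>) + t * \<gamma>"
proof -
  have n0: "0 < real n" using n by simp
  have p0: "\<And>i. i \<in> {1..n} \<Longrightarrow> 0 \<le> p i" and p1: "(\<Sum>i=1..n. p i) = 1"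
    using p by (auto simp: prob_vectors_def)
  \<comment> \<open>The factor \<open>sqrt n\<close> in the bound on \<open>w\<close> is moved over
    to \<open>q\<close>, whose scaled norm is at most \<open>t\<close>. This needs
    \<open>0 \<le> s\<close>, which follows from nonnegativity of the norm.\<close>
  have qw: "\<bar>\<Sum>i=1..n. q i * w i\<bar> \<le> t * s" if "L2_set w {1..n} \<le> sqrt n * s" for w s
  proof -
    have "0 \<le> sqrt n * s" using that L2_set_nonneg[of w "{1..n}"] by linarith
    then have s: "0 \<le> s" using n0 by (simp add: zero_le_mult_iff)
    have "\<bar>\<Sum>i=1..n. q i * w i\<bar> \<le> L2_set q {1..n} * L2_set w {1..n}"
      by (rule sum_mult_le_L2_set)
    also have "\<dots> \<le> L2_set q {1..n} * (sqrt n * s)"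
      by (intro mult_left_mono that L2_set_nonneg)
    also have "\<dots> = (sqrt n * L2_set q {1..n}) * s" by simp
    also have "\<dots> \<le> t * s" by (rule mult_right_mono[OF q s])
    finally show ?thesis .
  qed
  have split: "(\<Sum>i=1..n. p i * w i) = 1 / real n * (\<Sum>i=1..n. w i) + (\<Sum>i=1..n. q i * w i)" for w
    by (simp add: q_def sum_distrib_left sum.distrib[symmetric] algebra_simps)
  \<comment> \<open>Cauchy-Schwarz against the constant \<open>1\<close>: the mean is at most the
    root mean square.\<close>
  have "(\<Sum>i=1..n. b i) \<le> \<bar>\<Sum>i=1..n. 1 * b i\<bar>" by simp
  also have "\<dots> \<le> L2_set (\<lambda>_. 1) {1..n} * L2_set b {1..n}" by (rule sum_mult_le_L2_set)
  also have "\<dots> \<le> sqrt n * (sqrt n * \<beta>)"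
    using mult_left_mono[OF b, of "sqrt n"] by (simp add: L2_set_def[of "\<lambda>_. 1"])
  also have "\<dots> = n * \<beta>" by simp
  finally have mb: "1 / real n * (\<Sum>i=1..n. b i) \<le> \<beta>" using n0 by (simp add: field_simps)
  \<comment> \<open>The constant \<open>a\<close> survives because the weights sum to one. The
    \<open>p\<close>-average of \<open>b\<close> splits into its mean, at most
    \<open>\<beta>\<close>, and a sum against \<open>q\<close>, at most
    \<open>t * \<beta>\<close>.\<close>
  have "\<bar>\<Sum>i=1..n. p i * (u i - v i)\<bar> \<le> (\<Sum>i=1..n. p i * (K * (a + b i)))"
    using p0 uv by (intro order_trans[OF sum_abs] sum_mono) (auto simp: abs_mult intro!: mult_left_mono)
  also have "\<dots> = K * (a * (\<Sum>i=1..n. p i) + (\<Sum>i=1..n. p i * b i))"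
    by (simp add: sum_distrib_left sum.distrib algebra_simps)
  also have "\<dots> \<le> K * (a + (\<beta> + t * \<beta>))"
    unfolding p1 split[of b] using mb qw[OF b] \<open>0 \<le> K\<close> by (intro mult_left_mono) auto
  finally have "\<bar>\<Sum>i=1..n. p i * (u i - v i)\<bar> \<le> K * (a + \<beta> + t * \<beta>)" by (simp add: add.assoc)
  moreover have "(\<Sum>i=1..n. p i * u i) - 1 / real n * (\<Sum>i=1..n. v i)
      = (\<Sum>i=1..n. p i * (u i - v i)) + (\<Sum>i=1..n. q i * v i)"
    using split[of v] by (simp add: right_diff_distrib sum_subtractf)
  ultimately show ?thesis using qw[OF v] by linarith
qed

section \<open>Supports and independent errors\<close>

text \<open>The complement is the union of all open sets of measure zero.\<close>

lemma closed_rv_support: "closed (rv_support M V)"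
proof -
  have "- rv_support M V = \<Union>{U. open U \<and> emeasure (distr M borel V) U = 0}"
    by (auto simp: rv_support_def)
  then show ?thesis by (simp add: closed_def open_Union)
qed

text \<open>A point outside the support has an open null neighbourhood, hence a null neighbourhood
  from a countable basis; countably many of these cover the complement.\<close>

lemma AE_in_rv_support:
  fixes V :: "'w \<Rightarrow> 'a::second_countable_topology"
  assumes [measurable]: "V \<in> borel_measurable M"
  shows "AE \<omega> in M. V \<omega> \<in> rv_support M V"
proof -
  let ?D = "distr M borel V"
  obtain \<B> :: "'a set set" where \<B>: "countable \<B>" "topological_basis \<B>"
    using ex_countable_basis by blast
  define \<N> where "\<N> = {B \<in> \<B>. emeasure ?D B = 0}"
  have meas: "B \<in> sets borel" if "B \<in> \<N>" for B
    using that \<B>(2) by (auto simp: \<N>_def topological_basis_open)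
  have "(\<Union>B\<in>\<N>. B) \<in> null_sets ?D"
    by (rule null_sets_UN') (use \<B>(1) meas in \<open>auto simp: \<N>_def null_sets_def\<close>)
  moreover have "- rv_support M V \<subseteq> (\<Union>B\<in>\<N>. B)"
  proof
    fix v assume "v \<in> - rv_support M V"
    then obtain U where U: "open U" "v \<in> U" "emeasure ?D U = 0" by (auto simp: rv_support_def)
    then obtain B where B: "B \<in> \<B>" "v \<in> B" "B \<subseteq> U" using \<B>(2) by (metis topological_basisE)
    have "emeasure ?D B \<le> emeasure ?D U" using U B by (intro emeasure_mono) auto
    with U B show "v \<in> (\<Union>B\<in>\<N>. B)" by (auto simp: \<N>_def)
  qed
  ultimately have "AE v in ?D. v \<in> rv_support M V"
    by (intro AE_I'[of "\<Union>B\<in>\<N>. B"]) auto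
  then show ?thesis by (rule AE_distrD[OF assms])
qed

text \<open>The model itself only places \<open>f (X \<omega>) + \<epsilon> \<omega>\<close> in the
  support; independence is what allows \<open>x\<close> to be frozen while the error varies.\<close>

lemma (in prob_space) AE_indep_sum_in_rv_support:
  fixes X :: "'a \<Rightarrow> 'x::euclidean_space" and Y \<epsilon> :: "'a \<Rightarrow> 'y::euclidean_space"
  assumes [measurable]: "X \<in> borel_measurable M" "Y \<in> borel_measurable M"
      "f \<in> borel_measurable borel" "\<epsilon> \<in> borel_measurable M"
    and Y: "\<forall>\<omega>\<in>space M. Y \<omega> = f (X \<omega>) + \<epsilon> \<omega>"
    and indep: "indep_set (sets (vimage_algebra (space M) \<epsilon> borel))
      (sets (vimage_algebra (space M) X borel))"
  shows "AE x in distr M borel X. AE \<omega> in M. f x + \<epsilon> \<omega> \<in> rv_support M Y"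
proof -
  let ?S = "rv_support M Y"
  have [measurable]: "?S \<in> sets borel" using closed_rv_support by (rule borel_closed)
  interpret E: prob_space "distr M borel \<epsilon>" by (rule prob_space_distr) measurable
  interpret D: prob_space "distr M borel X" by (rule prob_space_distr) measurable
  interpret P: pair_sigma_finite "distr M borel \<epsilon>" "distr M borel X" ..
  \<comment> \<open>Independence gives the product formula on rectangles, which determines the joint
    law because both factors are sigma-finite.\<close>
  have prod: "distr M borel \<epsilon> \<Otimes>\<^sub>M distr M borel X = distr M (borel \<Otimes>\<^sub>M borel) (\<lambda>\<omega>. (\<epsilon> \<omega>, X \<omega>))"
  proof (rule pair_measure_eqI)
    fix A B assume "A \<in> sets (distr M borel \<epsilon>)" "B \<in> sets (distr M borel X)"
    then have [measurable]: "A \<in> sets borel" "B \<in> sets borel" by auto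
    let ?A = "\<epsilon> -` A \<inter> space M" and ?B = "X -` B \<inter> space M"
    have "(\<lambda>\<omega>. (\<epsilon> \<omega>, X \<omega>)) -` (A \<times> B) \<inter> space M = ?A \<inter> ?B" by auto
    moreover have "prob (?A \<inter> ?B) = prob ?A * prob ?B"
      using indep by (rule indep_setD) (auto intro: in_vimage_algebra)
    ultimately show "emeasure (distr M borel \<epsilon>) A * emeasure (distr M borel X) B
        = emeasure (distr M (borel \<Otimes>\<^sub>M borel) (\<lambda>\<omega>. (\<epsilon> \<omega>, X \<omega>))) (A \<times> B)"
      by (simp add: emeasure_distr emeasure_eq_measure ennreal_mult)
  qed (auto intro: E.sigma_finite_measure_axioms D.sigma_finite_measure_axioms)
  have "AE \<omega> in M. f (X \<omega>) + \<epsilon> \<omega> \<in> ?S"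
    using AE_in_rv_support[of Y M] Y by (auto elim: AE_mp)
  then have "AE w in distr M borel \<epsilon> \<Otimes>\<^sub>M distr M borel X. f (snd w) + fst w \<in> ?S"
    unfolding prod by (subst AE_distr_iff) auto
  then have "AE e in distr M borel \<epsilon>. AE x in distr M borel X. f x + e \<in> ?S"
    by (auto dest: P.AE_pair)
  \<comment> \<open>Slicing fixed the error first. The exchange needs a measurable event, provided
    by the closed support and the Borel function \<open>f\<close>.\<close>
  then have "AE x in distr M borel X. AE e in distr M borel \<epsilon>. f x + e \<in> ?S"
    by (rule P.AE_commute[THEN iffD1, rotated]) measurable
  then show ?thesis
    by (rule eventually_mono) (rule AE_distrD, measurable)
qed

section \<open>Atoms and weights of the ambiguity set\<close>

text \<open>The sign condition on the weights matters because \<open>ennreal\<close> sends negative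
  numbers to zero.\<close>

lemma integral_discrete_law:
  fixes h :: "'y::topological_space \<Rightarrow> real"
  assumes "h \<in> borel_measurable (restrict_space borel S)"
    and "\<And>i. i \<in> {1..n} \<Longrightarrow> ybar i \<in> S" and "\<And>i. i \<in> {1..n} \<Longrightarrow> 0 \<le> p i"
  shows "integral\<^sup>L (discrete_law S n p ybar) h = (\<Sum>i=1..n. p i * h (ybar i))"
proof -
  have "ybar \<in> measurable (point_measure {1..n} (\<lambda>i. ennreal (p i))) (restrict_space borel S)"
    using assms(2)
    by (auto simp: measurable_def space_point_measure sets_point_measure space_restrict_space)
  then show ?thesis
    unfolding discrete_law_def using assms(1,3)
    by (auto simp: integral_distr simp del: One_nat_def
        intro!: trans[OF lebesgue_integral_point_measure_finite])
qed

text \<open>Nonemptiness supplies the lower bound: a supremum over no laws would be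
  \<open>-\<infinity>\<close>.\<close>

lemma worst_case_diff_le:
  assumes "\<Q> \<noteq> {}" and "\<And>Q. Q \<in> \<Q> \<Longrightarrow> \<bar>integral\<^sup>L Q (c z) - r\<bar> \<le> d"
  shows "\<bar>worst_case c \<Q> z - ereal r\<bar> \<le> ereal d"
proof -
  obtain Q where Q: "Q \<in> \<Q>" using assms(1) by blast
  have "ereal (r - d) \<le> ereal (integral\<^sup>L Q (c z))" using assms(2)[OF Q] by (simp add: abs_le_iff)
  also have "\<dots> \<le> worst_case c \<Q> z" unfolding worst_case_def using Q by (rule SUP_upper)
  finally show ?thesis
    unfolding ereal_abs_diff_le_iff worst_case_def
    using assms(2) by (force simp: abs_le_iff intro!: SUP_least)
qed

text \<open>With \<open>v = f x\<close>, the vector assumed to lie in \<open>S\<close> is the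
  unobservable scenario \<open>f x + \<epsilon>s i\<close> that the atom approximates.\<close>

lemma atom_region_dist_le:
  assumes S: "closed S" "convex S" and w: "v + (fst (d i) - f (snd (d i))) \<in> S"
    and y: "y \<in> atom_region reg S n d x m i"
  shows "norm (y - (v + (fst (d i) - f (snd (d i)))))
    \<le> m + norm (fhat reg n d x - v) + norm (f (snd (d i)) - fhat reg n d (snd (d i)))"
proof -
  let ?w = "v + (fst (d i) - f (snd (d i)))" and ?u = "fhat reg n d x + residual reg n d i"
  have "norm (closest_point S ?u - ?w) \<le> norm (?u - ?w)"
    using closest_point_lipschitz[of S ?u ?w] S w by (auto simp: closest_point_self dist_norm)
  \<comment> \<open>The response \<open>fst (d i)\<close> cancels, which leaves the estimation
    errors at \<open>x\<close> and at the \<open>i\<close>-th covariate.\<close>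
  also have "?u - ?w = (fhat reg n d x - v) + (f (snd (d i)) - fhat reg n d (snd (d i)))"
    by (simp add: residual_def algebra_simps)
  also have "norm \<dots> \<le> norm (fhat reg n d x - v) + norm (f (snd (d i)) - fhat reg n d (snd (d i)))"
    by (rule norm_triangle_ineq)
  finally show ?thesis
    using y dist_triangle[of y ?w "closest_point S ?u"] unfolding atom_region_def dist_norm
    by simp
qed

text \<open>Multiplying the sum of squares by \<open>n\<close> turns the exponent
  \<open>-\<rho>\<close> into \<open>1 - \<rho>\<close>, which is still negative. The final square
  root explains the intermediate target \<open>e\<^sup>2\<close>.\<close>

lemma eventually_scaled_weight_deviation_le:
  fixes A :: "nat \<Rightarrow> (nat \<Rightarrow> real) set"
  assumes A: "\<And>n. 1 \<le> n \<Longrightarrow> A n \<subseteq> prob_vectors n" and "1 < \<rho>" "0 < (e::real)"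
    and O: "(\<lambda>n. SUP p\<in>A n. \<Sum>i=1..n. (p i - 1 / real n)\<^sup>2) \<in> O(\<lambda>n. real n powr (-\<rho>))"
  shows "\<forall>\<^sub>F n in sequentially. \<forall>p\<in>A n. sqrt n * L2_set (\<lambda>i. p i - 1 / real n) {1..n} \<le> e"
proof -
  let ?s = "\<lambda>n. SUP p\<in>A n. \<Sum>i=1..n. (p i - 1 / real n)\<^sup>2"
  obtain K where K: "\<forall>\<^sub>F n in sequentially. norm (?s n) \<le> K * norm (real n powr (-\<rho>))"
    using O by (elim landau_o.bigE)
  have "(\<lambda>n. real n powr (1 - \<rho>)) \<longlonglongrightarrow> 0"
    using \<open>1 < \<rho>\<close> by (intro tendsto_neg_powr filterlim_real_sequentially) simp
  then have "(\<lambda>n. K * real n powr (1 - \<rho>)) \<longlonglongrightarrow> 0"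
    using tendsto_mult_right_zero by blast
  then have "\<forall>\<^sub>F n in sequentially. K * real n powr (1 - \<rho>) < e\<^sup>2"
    using \<open>0 < e\<close> by (intro order_tendstoD) auto
  with K eventually_ge_at_top[of 1] show ?thesis
  proof eventually_elim
    case (elim n)
    then have n: "1 \<le> n" by simp
    show ?case
    proof
      fix p assume p: "p \<in> A n"
      \<comment> \<open>A real supremum bounds its members only for a family bounded above. Entries
        of probability vectors lie between \<open>0\<close> and \<open>1\<close>, so each squared
        deviation is at most \<open>1\<close>.\<close>
      have "(\<Sum>i=1..n. (r i - 1 / real n)\<^sup>2) \<le> real n" if "r \<in> A n" for r
      proof -
        have r: "\<forall>i\<in>{1..n}. 0 \<le> r i" "(\<Sum>i=1..n. r i) = 1"
          using A[OF n] that by (auto simp: prob_vectors_def)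
        have "(r i - 1 / real n)\<^sup>2 \<le> 1" if i: "i \<in> {1..n}" for i
        proof -
          have "r i \<le> 1" using member_le_sum[of i "{1..n}" r] r i by auto
          moreover have "0 \<le> r i" using r i by auto
          moreover have "0 \<le> 1 / real n" "1 / real n \<le> 1" using n by auto
          ultimately have "\<bar>r i - 1 / real n\<bar> \<le> 1" by linarith
          then show ?thesis by (simp add: abs_square_le_1)
        qed
        then have "(\<Sum>i=1..n. (r i - 1 / real n)\<^sup>2) \<le> (\<Sum>i=1..n. 1)" by (intro sum_mono)
        then show ?thesis by simp
      qed
      then have "bdd_above ((\<lambda>p. \<Sum>i=1..n. (p i - 1 / real n)\<^sup>2) ` A n)" by (intro bdd_aboveI2)
      then have "(\<Sum>i=1..n. (p i - 1 / real n)\<^sup>2) \<le> ?s n" using p by (intro cSUP_upper)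
      also have "\<dots> \<le> K * real n powr (-\<rho>)" using elim by simp
      finally have "real n * (\<Sum>i=1..n. (p i - 1 / real n)\<^sup>2) \<le> real n * (K * real n powr (-\<rho>))"
        by (intro mult_left_mono) auto
      also have "\<dots> = K * real n powr (1 - \<rho>)"
        using n by (simp add: powr_diff powr_minus field_simps)
      also have "\<dots> \<le> e\<^sup>2" using elim by simp
      finally have "sqrt (real n * (\<Sum>i=1..n. (p i - 1 / real n)\<^sup>2)) \<le> e"
        using \<open>0 < e\<close> by (intro real_le_lsqrt) (auto intro!: mult_nonneg_nonneg sum_nonneg)
      then show "sqrt n * L2_set (\<lambda>i. p i - 1 / real n) {1..n} \<le> e"
        by (simp add: L2_set_def real_sqrt_mult)
    qed
  qed
qed

section \<open>Convergence of the robust problem at almost every covariate\<close>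

theorem theorem16:
  fixes M :: "'w measure" and N :: "'v measure"
    and X :: "'w \<Rightarrow> 'x::euclidean_space" and Y \<epsilon> :: "'w \<Rightarrow> 'y::euclidean_space"
    and f :: "'x \<Rightarrow> 'y"
    and xs :: "nat \<Rightarrow> 'v \<Rightarrow> 'x" and ys \<epsilon>s :: "nat \<Rightarrow> 'v \<Rightarrow> 'y"
    and \<X> :: "'x set" and \<Y> :: "'y set" and Z :: "'z::euclidean_space set"
    and c :: "'z \<Rightarrow> 'y \<Rightarrow> real" and L :: "'z \<Rightarrow> real"
    and reg :: "nat \<Rightarrow> (nat \<Rightarrow> 'y \<times> 'x) \<Rightarrow> 'x \<Rightarrow> 'y"
    and \<PP> :: "nat \<Rightarrow> 'x \<Rightarrow> real \<Rightarrow> (nat \<Rightarrow> real) set"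
    and \<mu> \<zeta> :: "nat \<Rightarrow> 'x \<Rightarrow> real" and \<rho> :: real
    and PX :: "'x measure"
    and g :: "'z \<Rightarrow> 'x \<Rightarrow> real" and gstar :: "nat \<Rightarrow> 'v \<Rightarrow> 'z \<Rightarrow> 'x \<Rightarrow> real"
    and data :: "'v \<Rightarrow> nat \<Rightarrow> 'y \<times> 'x" and fn :: "nat \<Rightarrow> 'v \<Rightarrow> 'x \<Rightarrow> 'y"
    and obj :: "nat \<Rightarrow> 'v \<Rightarrow> 'x \<Rightarrow> 'z \<Rightarrow> ereal"
    and vstar :: "'x \<Rightarrow> ereal" and Sstar :: "'x \<Rightarrow> 'z set"
    and vDRO :: "nat \<Rightarrow> 'v \<Rightarrow> 'x \<Rightarrow> ereal" and SDRO :: "nat \<Rightarrow> 'v \<Rightarrow> 'x \<Rightarrow> 'z set"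
  defines "PX \<equiv> distr M borel X"
    and "\<X> \<equiv> rv_support M X"
    and "\<Y> \<equiv> rv_support M Y"
    and "g \<equiv> \<lambda>z x. integral\<^sup>L M (\<lambda>\<omega>. c z (f x + \<epsilon> \<omega>))"
    and "\<epsilon>s \<equiv> \<lambda>i \<omega>. ys i \<omega> - f (xs i \<omega>)"
    and "gstar \<equiv> \<lambda>n \<omega> z x. (1 / real n) * (\<Sum>i=1..n. c z (f x + \<epsilon>s i \<omega>))"
    and "data \<equiv> \<lambda>\<omega> i. (ys i \<omega>, xs i \<omega>)"
    and "fn \<equiv> \<lambda>n \<omega>. fhat reg n (data \<omega>)"
    and "obj \<equiv> \<lambda>n \<omega> x. worst_case c (ambiguity_set reg \<Y> \<PP> \<mu> \<zeta> n (data \<omega>) x)"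
    and "vstar \<equiv> \<lambda>x. opt_value Z (\<lambda>z. ereal (g z x))"
    and "Sstar \<equiv> \<lambda>x. opt_set Z (\<lambda>z. ereal (g z x))"
    and "vDRO \<equiv> \<lambda>n \<omega> x. opt_value Z (obj n \<omega> x)"
    and "SDRO \<equiv> \<lambda>n \<omega> x. opt_set Z (obj n \<omega> x)"
  assumes \<comment> \<open>the population model\<close>
        "prob_space M"
    and "X \<in> borel_measurable M" and "Y \<in> borel_measurable M"
    and "\<Y> \<noteq> {}" and "convex \<Y>"
    and "f \<in> borel_measurable borel"
    and "integrable M Y"
    and "\<forall>b\<in>Basis. AE \<omega> in M.
           real_cond_exp M (vimage_algebra (space M) X borel) (\<lambda>\<omega>. Y \<omega> \<bullet> b) \<omega> = f (X \<omega>) \<bullet> b"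
    and "\<forall>\<omega>\<in>space M. Y \<omega> = f (X \<omega>) + \<epsilon> \<omega>"
    and "has_bochner_integral M \<epsilon> 0"
    and "prob_space.indep_set M (sets (vimage_algebra (space M) \<epsilon> borel))
                               (sets (vimage_algebra (space M) X borel))"
  \<comment> \<open>the true problem\<close>
    and "Z \<noteq> {}" and "compact Z"
    and "(\<lambda>(z, y). c z y) \<in> borel_measurable (restrict_space borel (Z \<times> \<Y>))"
    and "AE x\<in>\<X> in PX. \<forall>z\<in>Z. integrable M (\<lambda>\<omega>. c z (f x + \<epsilon> \<omega>))"
    and "AE x\<in>\<X> in PX. lsc_on Z (\<lambda>z. ereal (g z x))"
  \<comment> \<open>the data: no independence between observations is assumed\<close>
    and "prob_space N"
    and "\<forall>i\<ge>1. xs i \<in> borel_measurable N" and "\<forall>i\<ge>1. ys i \<in> borel_measurable N"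
    and "\<forall>i\<ge>1. distr N (borel \<Otimes>\<^sub>M borel) (\<lambda>\<omega>. (ys i \<omega>, xs i \<omega>))
                 = distr M (borel \<Otimes>\<^sub>M borel) (\<lambda>\<omega>. (Y \<omega>, X \<omega>))"
    and "\<forall>n\<ge>1. (\<lambda>(d, x). reg n d x)
           \<in> borel_measurable ((\<Pi>\<^sub>M i\<in>{1..n}. borel \<Otimes>\<^sub>M borel) \<Otimes>\<^sub>M borel)"
  \<comment> \<open>the ambiguity set and the ER-DRO problem\<close>
    and "\<forall>n\<ge>1. \<forall>x\<in>\<X>. 0 \<le> \<mu> n x \<and> 0 \<le> \<zeta> n x"
    and "\<forall>n\<ge>1. \<mu> n \<in> borel_measurable borel \<and> \<zeta> n \<in> borel_measurable borel"
    and "\<forall>n\<ge>1. \<forall>x\<in>\<X>. \<forall>\<zeta>'\<ge>0. \<PP> n x \<zeta>' \<subseteq> prob_vectors n"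
    and "\<forall>n\<ge>1. \<forall>x\<in>\<X>. \<PP> n x 0 = {uniform_vector n}"
    and "\<forall>n\<ge>1. \<forall>x\<in>\<X>. set_converges (\<PP> n x) (\<PP> n x 0) (at_right 0)"
    and "\<forall>n\<ge>1. \<forall>\<omega>\<in>space N. \<forall>x\<in>\<X>. \<forall>z\<in>Z. \<bar>obj n \<omega> x z\<bar> \<noteq> \<infinity>"
    and "\<forall>n\<ge>1. \<forall>\<omega>\<in>space N. \<forall>x\<in>\<X>. lsc_on Z (obj n \<omega> x)"
  \<comment> \<open>conditions of the convergence theorem\<close>
    and "\<forall>z\<in>Z. (L z)-lipschitz_on \<Y> (c z)" and "bdd_above (L ` Z)"
    and "AE x\<in>\<X> in PX. conv_in_prob N (\<lambda>n \<omega>. SUP z\<in>Z. ereal \<bar>gstar n \<omega> z x - g z x\<bar>) 0"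
    and "AE x\<in>\<X> in PX. conv_in_prob N (\<lambda>n \<omega>. ereal (norm (fn n \<omega> x - f x))) 0"
    and "conv_in_prob N
           (\<lambda>n \<omega>. ereal ((1 / real n) * (\<Sum>i=1..n. (norm (f (xs i \<omega>) - fn n \<omega> (xs i \<omega>)))\<^sup>2))) 0"
    and "1 < \<rho>"
    and "AE x\<in>\<X> in PX. (\<lambda>n. SUP p\<in>\<PP> n x (\<zeta> n x). \<Sum>i=1..n. (p i - 1 / real n)\<^sup>2)
           \<in> O(\<lambda>n. real n powr (-\<rho>))"
    and "AE x\<in>\<X> in PX. (SUP z\<in>Z. \<integral>\<^sup>+\<omega>. ennreal ((c z (f x + \<epsilon> \<omega>))\<^sup>2) \<partial>M) < \<infinity>"
    and "AE x\<in>\<X> in PX. conv_in_prob N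
           (\<lambda>n \<omega>. SUP z\<in>Z. ereal \<bar>(1 / real n) * (\<Sum>i=1..n. (c z (f x + \<epsilon>s i \<omega>))\<^sup>2)
                                   - integral\<^sup>L M (\<lambda>\<omega>'. (c z (f x + \<epsilon> \<omega>'))\<^sup>2)\<bar>) 0"
    and "AE x\<in>\<X> in PX. (\<lambda>n. \<mu> n x) \<longlonglongrightarrow> 0"
  shows "AE x\<in>\<X> in PX.
           conv_in_prob N (\<lambda>n \<omega>. vDRO n \<omega> x) (vstar x)
         \<and> conv_in_prob N (\<lambda>n \<omega>. deviation (SDRO n \<omega> x) (Sstar x)) 0
         \<and> conv_in_prob N (\<lambda>n \<omega>. SUP z\<in>SDRO n \<omega> x. ereal (g z x)) (vstar x)"
  proof -
  interpret prob_space M by fact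
  have \<epsilon>_meas [measurable]: "\<epsilon> \<in> borel_measurable M"
    using \<open>has_bochner_integral M \<epsilon> 0\<close>
    by (intro borel_measurable_integrable) (auto intro: integrable.intros)
  note [measurable] = \<open>X \<in> borel_measurable M\<close> \<open>Y \<in> borel_measurable M\<close> \<open>f \<in> borel_measurable borel\<close>
  have Y_closed: "closed \<Y>" unfolding \<Y>_def by (rule closed_rv_support)
  then have Y_meas [measurable]: "\<Y> \<in> sets borel" by (rule borel_closed)
  obtain L0 where "\<And>z. z \<in> Z \<Longrightarrow> L z \<le> L0"
    using \<open>bdd_above (L ` Z)\<close> by (auto simp: bdd_above_def)
  \<comment> \<open>One nonnegative Lipschitz constant for all decisions \<open>z\<close>, so that
    later bounds are uniform over \<open>Z\<close>.\<close>
  then have "(max L0 0)-lipschitz_on \<Y> (c z)" if "z \<in> Z" for z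
    using \<open>\<forall>z\<in>Z. (L z)-lipschitz_on \<Y> (c z)\<close> that by (force intro: lipschitz_on_mono)
  then obtain K where K: "0 \<le> K" "\<And>z. z \<in> Z \<Longrightarrow> K-lipschitz_on \<Y> (c z)"
    by (metis max.cobounded2)
  have c_meas: "c z \<in> borel_measurable (restrict_space borel \<Y>)" if "z \<in> Z" for z
    using K(2)[OF that] by (intro borel_measurable_continuous_on_restrict lipschitz_on_continuous_on)
  have "AE x in PX. AE \<omega> in M. f x + \<epsilon> \<omega> \<in> \<Y>"
    unfolding PX_def \<Y>_def
    by (rule AE_indep_sum_in_rv_support) fact+
  moreover note
    \<open>AE x\<in>\<X> in PX. lsc_on Z (\<lambda>z. ereal (g z x))\<close>
    \<open>AE x\<in>\<X> in PX. conv_in_prob N (\<lambda>n \<omega>. SUP z\<in>Z. ereal \<bar>gstar n \<omega> z x - g z x\<bar>) 0\<close>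
    \<open>AE x\<in>\<X> in PX. conv_in_prob N (\<lambda>n \<omega>. ereal (norm (fn n \<omega> x - f x))) 0\<close>
    \<open>AE x\<in>\<X> in PX. (\<lambda>n. SUP p\<in>\<PP> n x (\<zeta> n x). \<Sum>i=1..n. (p i - 1 / real n)\<^sup>2)
           \<in> O(\<lambda>n. real n powr (-\<rho>))\<close>
    \<open>AE x\<in>\<X> in PX. (SUP z\<in>Z. \<integral>\<^sup>+\<omega>. ennreal ((c z (f x + \<epsilon> \<omega>))\<^sup>2) \<partial>M) < \<infinity>\<close>
    \<open>AE x\<in>\<X> in PX. conv_in_prob N
           (\<lambda>n \<omega>. SUP z\<in>Z. ereal \<bar>(1 / real n) * (\<Sum>i=1..n. (c z (f x + \<epsilon>s i \<omega>))\<^sup>2)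
                                   - integral\<^sup>L M (\<lambda>\<omega>'. (c z (f x + \<epsilon> \<omega>'))\<^sup>2)\<bar>) 0\<close>
    \<open>AE x\<in>\<X> in PX. (\<lambda>n. \<mu> n x) \<longlonglongrightarrow> 0\<close>
  ultimately show ?thesis
  proof eventually_elim
    case (elim x)
    show ?case
    proof
      assume x: "x \<in> \<X>"
      note hyps = elim(2-8)[rule_format, OF x]
      \<comment> \<open>Each observed pair has the law of \<open>(Y, X)\<close>, so the almost sure
        membership of \<open>f x + \<epsilon>\<close> carries over to every
        \<open>f x + \<epsilon>s i\<close>, and for each \<open>n\<close> only finitely many indices
        occur.\<close>
      have supp: "with_high_prob N (\<lambda>n \<omega>. \<forall>i\<in>{1..n}. f x + \<epsilon>s i \<omega> \<in> \<Y>)"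
      proof (rule with_high_prob_AE, rule AE_finite_allI)
        fix n i :: nat assume "i \<in> {1..n}"
        then have i: "1 \<le> i" by simp
        let ?B = "borel \<Otimes>\<^sub>M borel :: ('y \<times> 'x) measure"
        have [measurable]: "xs i \<in> borel_measurable N" "ys i \<in> borel_measurable N"
          using i \<open>\<forall>i\<ge>1. xs i \<in> borel_measurable N\<close> \<open>\<forall>i\<ge>1. ys i \<in> borel_measurable N\<close> by auto
        have "AE w in distr M ?B (\<lambda>\<omega>. (Y \<omega>, X \<omega>)). f x + (fst w - f (snd w)) \<in> \<Y>"
          using elim(1) \<open>\<forall>\<omega>\<in>space M. Y \<omega> = f (X \<omega>) + \<epsilon> \<omega>\<close>
          by (subst AE_distr_iff) (auto elim: AE_mp)
        also have "distr M ?B (\<lambda>\<omega>. (Y \<omega>, X \<omega>)) = distr N ?B (\<lambda>\<omega>. (ys i \<omega>, xs i \<omega>))"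
          using i \<open>\<forall>i\<ge>1. distr N ?B (\<lambda>\<omega>. (ys i \<omega>, xs i \<omega>)) = distr M ?B (\<lambda>\<omega>. (Y \<omega>, X \<omega>))\<close> by simp
        finally show "AE \<omega> in N. f x + \<epsilon>s i \<omega> \<in> \<Y>"
          by (subst (asm) AE_distr_iff) (auto simp: \<epsilon>s_def)
      qed simp
      obtain C where C: "0 \<le> C" "(SUP z\<in>Z. \<integral>\<^sup>+\<omega>. ennreal ((c z (f x + \<epsilon> \<omega>))\<^sup>2) \<partial>M) = ennreal C"
        using hyps(5) by (intro that[OF enn2real_nonneg ennreal_enn2real[symmetric]]) simp
      \<comment> \<open>If the square is not integrable, the Bochner integral takes its default
        value \<open>0\<close>, and the bound holds because \<open>C\<close> is nonnegative.\<close>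
      have moment: "integral\<^sup>L M (\<lambda>\<omega>. (c z (f x + \<epsilon> \<omega>))\<^sup>2) \<le> C" if "z \<in> Z" for z
      proof (cases "integrable M (\<lambda>\<omega>. (c z (f x + \<epsilon> \<omega>))\<^sup>2)")
        case True
        have "ennreal (integral\<^sup>L M (\<lambda>\<omega>. (c z (f x + \<epsilon> \<omega>))\<^sup>2)) = (\<integral>\<^sup>+\<omega>. ennreal ((c z (f x + \<epsilon> \<omega>))\<^sup>2) \<partial>M)"
          using True by (intro nn_integral_eq_integral[symmetric]) auto
        also have "\<dots> \<le> ennreal C"
          unfolding C(2)[symmetric] using that by (rule SUP_upper)
        finally show ?thesis using C(1) by simp
      qed (use C(1) in \<open>simp add: not_integrable_integral_eq\<close>)
      have unif: "with_high_prob N (\<lambda>n \<omega>. \<forall>z\<in>Z. \<bar>obj n \<omega> x z - ereal (g z x)\<bar> \<le> ereal d)"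
        if "0 < d" for d
      proof -
        \<comment> \<open>Bound for the empirical root mean square of \<open>c z\<close>:
          \<open>C\<close> for the true second moment plus the tolerance \<open>1\<close> granted to
          its empirical version.\<close>
        define \<gamma> where "\<gamma> = sqrt (C + 1)"
        have \<gamma>: "0 \<le> \<gamma>" "\<gamma>\<^sup>2 = C + 1" using C(1) by (auto simp: \<gamma>_def)
        \<comment> \<open>One tolerance for the radius, the error at \<open>x\<close>, the root mean
          square error and the weight deviation. Since \<open>\<eta> \<le> 1\<close> gives
          \<open>\<eta> * \<eta> \<le> \<eta>\<close>, the total is at most
          \<open>\<eta> * (4 * K + \<gamma>)\<close>; the added \<open>1\<close> keeps the
          denominator positive.\<close>
        define \<eta> where "\<eta> = min 1 (d / 2 / (4 * K + \<gamma> + 1))"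
        have den: "0 < 4 * K + \<gamma> + 1" using K(1) \<gamma>(1) by linarith
        have \<eta>: "0 < \<eta>" "\<eta> \<le> 1" using den \<open>0 < d\<close> by (auto simp: \<eta>_def)
        have "\<eta> \<le> d / 2 / (4 * K + \<gamma> + 1)" by (simp only: \<eta>_def min.cobounded2)
        then have "\<eta> * (4 * K + \<gamma> + 1) \<le> d / 2" using pos_le_divide_eq[OF den] by blast
        then have "4 * K * \<eta> + \<gamma> * \<eta> \<le> d / 2" using \<eta>(1) by (simp add: algebra_simps)
        moreover have "K * (\<eta> + \<eta> + \<eta> + \<eta> * \<eta>) \<le> K * (4 * \<eta>)"
          using \<eta> K(1) by (intro mult_left_mono) (auto simp: mult_left_le)
        ultimately have \<eta>_le: "K * (\<eta> + \<eta> + \<eta> + \<eta> * \<eta>) + \<eta> * \<gamma> \<le> d / 2"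
          by (simp add: algebra_simps)
        \<comment> \<open>Half of \<open>d\<close> is spent on \<open>gstar\<close> against
          \<open>g\<close>, the other half on the robust objective against
          \<open>gstar\<close>.\<close>
        have "with_high_prob N (\<lambda>n \<omega>. \<bar>(SUP z\<in>Z. ereal \<bar>gstar n \<omega> z x - g z x\<bar>) - 0\<bar> \<le> ereal (d / 2))"
          using \<open>0 < d\<close> by (intro conv_in_probD[OF hyps(2)]) simp
        moreover have "with_high_prob N (\<lambda>n \<omega>. \<bar>ereal (norm (fn n \<omega> x - f x)) - 0\<bar> \<le> ereal \<eta>)"
          by (rule conv_in_probD[OF hyps(3) \<eta>(1)])
        \<comment> \<open>The tolerance is squared because it bounds a mean of squares, whose root
          should be at most \<open>\<eta>\<close>.\<close>
        moreover have "with_high_prob N (\<lambda>n \<omega>. \<bar>ereal ((1 / real n) *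
            (\<Sum>i=1..n. (norm (f (xs i \<omega>) - fn n \<omega> (xs i \<omega>)))\<^sup>2)) - 0\<bar> \<le> ereal (\<eta>\<^sup>2))"
          using \<open>conv_in_prob N (\<lambda>n \<omega>. ereal ((1 / real n) *
              (\<Sum>i=1..n. (norm (f (xs i \<omega>) - fn n \<omega> (xs i \<omega>)))\<^sup>2))) 0\<close> \<eta>
          by (intro conv_in_probD) simp_all
        moreover have "with_high_prob N (\<lambda>n \<omega>. \<bar>(SUP z\<in>Z. ereal \<bar>(1 / real n) *
            (\<Sum>i=1..n. (c z (f x + \<epsilon>s i \<omega>))\<^sup>2) - integral\<^sup>L M (\<lambda>\<omega>'. (c z (f x + \<epsilon> \<omega>'))\<^sup>2)\<bar>) - 0\<bar> \<le> ereal 1)"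
          by (rule conv_in_probD[OF hyps(6) zero_less_one])
        moreover note supp
        ultimately have good: "with_high_prob N (\<lambda>n \<omega>.
            \<bar>(SUP z\<in>Z. ereal \<bar>gstar n \<omega> z x - g z x\<bar>) - 0\<bar> \<le> ereal (d / 2)
          \<and> \<bar>ereal (norm (fn n \<omega> x - f x)) - 0\<bar> \<le> ereal \<eta>
          \<and> \<bar>ereal ((1 / real n) * (\<Sum>i=1..n. (norm (f (xs i \<omega>) - fn n \<omega> (xs i \<omega>)))\<^sup>2)) - 0\<bar> \<le> ereal (\<eta>\<^sup>2)
          \<and> \<bar>(SUP z\<in>Z. ereal \<bar>(1 / real n) * (\<Sum>i=1..n. (c z (f x + \<epsilon>s i \<omega>))\<^sup>2)
              - integral\<^sup>L M (\<lambda>\<omega>'. (c z (f x + \<epsilon> \<omega>'))\<^sup>2)\<bar>) - 0\<bar> \<le> ereal 1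
          \<and> (\<forall>i\<in>{1..n}. f x + \<epsilon>s i \<omega> \<in> \<Y>))"
          by (intro with_high_prob_conj)
        have PP: "\<PP> n x (\<zeta> n x) \<subseteq> prob_vectors n" if "1 \<le> n" for n
          using that x \<open>\<forall>n\<ge>1. \<forall>x\<in>\<X>. \<forall>\<zeta>'\<ge>0. \<PP> n x \<zeta>' \<subseteq> prob_vectors n\<close>
            \<open>\<forall>n\<ge>1. \<forall>x\<in>\<X>. 0 \<le> \<mu> n x \<and> 0 \<le> \<zeta> n x\<close> by blast
        have "\<forall>\<^sub>F n in sequentially. \<forall>p\<in>\<PP> n x (\<zeta> n x).
            sqrt n * L2_set (\<lambda>i. p i - 1 / real n) {1..n} \<le> \<eta>"
          by (rule eventually_scaled_weight_deviation_le[OF PP \<open>1 < \<rho>\<close> \<eta>(1) hyps(4)])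
        moreover have "\<forall>\<^sub>F n in sequentially. \<mu> n x < \<eta>"
          using hyps(7) \<eta>(1) by (rule order_tendstoD)
        ultimately have large: "\<forall>\<^sub>F n in sequentially. 1 \<le> n \<and> \<mu> n x < \<eta> \<and>
            (\<forall>p\<in>\<PP> n x (\<zeta> n x). sqrt n * L2_set (\<lambda>i. p i - 1 / real n) {1..n} \<le> \<eta>)"
          using eventually_ge_at_top[of 1] by eventually_elim auto
        show ?thesis
        proof (rule with_high_prob_mono[OF good], use large in eventually_elim, intro ballI impI, elim conjE)
          fix n \<omega> z
          assume n: "1 \<le> n" and \<mu>: "\<mu> n x < \<eta>"
            and radius: "\<forall>p\<in>\<PP> n x (\<zeta> n x). sqrt n * L2_set (\<lambda>i. p i - 1 / real n) {1..n} \<le> \<eta>"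
            and \<omega>: "\<omega> \<in> space N" and z: "z \<in> Z"
            and G: "\<bar>(SUP z\<in>Z. ereal \<bar>gstar n \<omega> z x - g z x\<bar>) - 0\<bar> \<le> ereal (d / 2)"
            and F: "\<bar>ereal (norm (fn n \<omega> x - f x)) - 0\<bar> \<le> ereal \<eta>"
            and R: "\<bar>ereal ((1 / real n) * (\<Sum>i=1..n. (norm (f (xs i \<omega>) - fn n \<omega> (xs i \<omega>)))\<^sup>2)) - 0\<bar>
              \<le> ereal (\<eta>\<^sup>2)"
            and V: "\<bar>(SUP z\<in>Z. ereal \<bar>(1 / real n) * (\<Sum>i=1..n. (c z (f x + \<epsilon>s i \<omega>))\<^sup>2)
              - integral\<^sup>L M (\<lambda>\<omega>'. (c z (f x + \<epsilon> \<omega>'))\<^sup>2)\<bar>) - 0\<bar> \<le> ereal 1"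
            and S: "\<forall>i\<in>{1..n}. f x + \<epsilon>s i \<omega> \<in> \<Y>"
          have SUP_D: "h z \<le> e" if "\<bar>(SUP z\<in>Z. ereal (h z)) - 0\<bar> \<le> ereal e" for h e
          proof -
            have "ereal (h z) \<le> (SUP z\<in>Z. ereal (h z))" using z by (rule SUP_upper)
            also have "\<dots> \<le> ereal e" using that by (cases "SUP z\<in>Z. ereal (h z)") auto
            finally show ?thesis by simp
          qed
          define b where "b i = norm (f (xs i \<omega>) - fn n \<omega> (xs i \<omega>))" for i
          have n0: "0 < real n" using n by simp
          have "(\<Sum>i=1..n. (b i)\<^sup>2) \<le> real n * \<eta>\<^sup>2"
            using R n0 by (simp add: b_def field_simps)
          then have b: "L2_set b {1..n} \<le> sqrt n * \<eta>"
            using \<eta>(1) by (auto simp: L2_set_def real_sqrt_mult dest: real_sqrt_le_mono)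
          have "(1 / real n) * (\<Sum>i=1..n. (c z (f x + \<epsilon>s i \<omega>))\<^sup>2) \<le> \<gamma>\<^sup>2"
            using SUP_D[OF V] moment[OF z] \<gamma>(2) by linarith
          then have "(\<Sum>i=1..n. (c z (f x + \<epsilon>s i \<omega>))\<^sup>2) \<le> real n * \<gamma>\<^sup>2"
            using n0 by (simp add: field_simps)
          then have v: "L2_set (\<lambda>i. c z (f x + \<epsilon>s i \<omega>)) {1..n} \<le> sqrt n * \<gamma>"
            using \<gamma>(1) by (auto simp: L2_set_def real_sqrt_mult dest: real_sqrt_le_mono)
          have "\<bar>obj n \<omega> x z - ereal (gstar n \<omega> z x)\<bar> \<le> ereal (d / 2)"
            unfolding obj_def
          proof (rule worst_case_diff_le)
            \<comment> \<open>Nonemptiness is read off from the finiteness of the objective, which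
              would be \<open>-\<infinity>\<close> over an empty set.\<close>
            show "ambiguity_set reg \<Y> \<PP> \<mu> \<zeta> n (data \<omega>) x \<noteq> {}"
            proof
              assume "ambiguity_set reg \<Y> \<PP> \<mu> \<zeta> n (data \<omega>) x = {}"
              then have "obj n \<omega> x z = - \<infinity>"
                by (simp add: obj_def worst_case_def bot_ereal_def)
              with n x \<omega> z \<open>\<forall>n\<ge>1. \<forall>\<omega>\<in>space N. \<forall>x\<in>\<X>. \<forall>z\<in>Z. \<bar>obj n \<omega> x z\<bar> \<noteq> \<infinity>\<close> show False
                by fastforce
            qed
          next
            fix Q assume "Q \<in> ambiguity_set reg \<Y> \<PP> \<mu> \<zeta> n (data \<omega>) x"
            then obtain p ybar where Q: "Q = discrete_law \<Y> n p ybar" and p: "p \<in> \<PP> n x (\<zeta> n x)"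
              and ybar: "\<And>i. i \<in> {1..n} \<Longrightarrow> ybar i \<in> atom_region reg \<Y> n (data \<omega>) x (\<mu> n x) i"
              by (auto simp: ambiguity_set_def)
            have ybar_in: "ybar i \<in> \<Y>" if "i \<in> {1..n}" for i
              using ybar[OF that] by (simp add: atom_region_def)
            have p': "p \<in> prob_vectors n" using PP[OF n] p by blast
            then have "integral\<^sup>L Q (c z) = (\<Sum>i=1..n. p i * c z (ybar i))"
              unfolding Q using c_meas[OF z] ybar_in
              by (intro integral_discrete_law) (auto simp: prob_vectors_def)
            moreover have "\<bar>(\<Sum>i=1..n. p i * c z (ybar i))
                - 1 / real n * (\<Sum>i=1..n. c z (f x + \<epsilon>s i \<omega>))\<bar> \<le> K * (\<eta> + \<eta> + \<eta> + \<eta> * \<eta>) + \<eta> * \<gamma>"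
            \<comment> \<open>Here \<open>a = \<eta> + \<eta>\<close> collects the radius and the
              error at \<open>x\<close>, which are uniform in \<open>i\<close>, while
              \<open>b i\<close> is controlled only in mean square; \<open>\<beta>\<close> and
              \<open>t\<close> are both \<open>\<eta>\<close>.\<close>
            proof (rule weighted_average_diff_le[OF n p' K(1) _ _ b v])
              show "sqrt n * L2_set (\<lambda>i. p i - 1 / real n) {1..n} \<le> \<eta>" using radius p by blast
            next
              fix i assume i: "i \<in> {1..n}"
              have "norm (ybar i - (f x + \<epsilon>s i \<omega>)) \<le> \<mu> n x + norm (fn n \<omega> x - f x) + b i"
                using atom_region_dist_le[OF Y_closed \<open>convex \<Y>\<close> _ ybar[OF i], where v = "f x" and f = f] S i
                by (simp add: data_def \<epsilon>s_def fn_def b_def)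
              also have "\<dots> \<le> \<eta> + \<eta> + b i" using \<mu> F by simp
              finally have dist: "norm (ybar i - (f x + \<epsilon>s i \<omega>)) \<le> \<eta> + \<eta> + b i" .
              have "\<bar>c z (ybar i) - c z (f x + \<epsilon>s i \<omega>)\<bar> \<le> K * norm (ybar i - (f x + \<epsilon>s i \<omega>))"
                using lipschitz_onD[OF K(2)[OF z] ybar_in[OF i]] S i by (auto simp: dist_norm)
              also have "\<dots> \<le> K * (\<eta> + \<eta> + b i)" by (rule mult_left_mono[OF dist K(1)])
              finally show "\<bar>c z (ybar i) - c z (f x + \<epsilon>s i \<omega>)\<bar> \<le> K * (\<eta> + \<eta> + b i)" .
            qed
            ultimately show "\<bar>integral\<^sup>L Q (c z) - gstar n \<omega> z x\<bar> \<le> d / 2"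
              unfolding gstar_def using \<eta>_le by simp
          qed
          moreover have "\<bar>gstar n \<omega> z x - g z x\<bar> \<le> d / 2" by (rule SUP_D[OF G])
          ultimately show "\<bar>obj n \<omega> x z - ereal (g z x)\<bar> \<le> ereal d"
            using ereal_abs_diff_triangle by fastforce
        qed
      qed
      have lsc: "lsc_on Z (obj n \<omega> x)" if "1 \<le> n" "\<omega> \<in> space N" for n \<omega>
        using that x \<open>\<forall>n\<ge>1. \<forall>\<omega>\<in>space N. \<forall>x\<in>\<X>. lsc_on Z (obj n \<omega> x)\<close> by blast
      show "conv_in_prob N (\<lambda>n \<omega>. vDRO n \<omega> x) (vstar x)
           \<and> conv_in_prob N (\<lambda>n \<omega>. deviation (SDRO n \<omega> x) (Sstar x)) 0
           \<and> conv_in_prob N (\<lambda>n \<omega>. SUP z\<in>SDRO n \<omega> x. ereal (g z x)) (vstar x)"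
        unfolding vDRO_def SDRO_def vstar_def Sstar_def
        using conv_in_prob_optimization[where h = "\<lambda>n \<omega>. obj n \<omega> x",
            OF \<open>compact Z\<close> \<open>Z \<noteq> {}\<close> hyps(1) lsc unif] by blast
    qed
  qed
qed

end
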